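(* Let $X\sim\operatorname{GP}(\sigma,\gamma,\pi,\ell)$ be a $d$-variate generalized Pareto random vector, let $\varnothing\ne J\subset\{1,\dots,d\}$, and let $u\in[0,\infty)^J$ be such that $\Pr[X_j>u_j]>0$ for all $j\in J$. Then $$\mathcal L(X_J-u\mid X_J\not\le u)=\operatorname{GP}\Bigl(\sigma_J+\gamma_Ju,\ \gamma_J,\ \bigl(\Pr[X_j>u_j\mid X_J\not\le u]\bigr)_{j\in J},\ \ell_J\Bigr).$$
   Context: Conventions: operations and order relations between vectors are componentwise; $a\wedge b=\min(a,b)$; $\mathcal L$ denotes (conditional) law; for a vector $x$ of length $d$, $x_J=(x_j)_{j\in J}$; $X_J\not\le u$ means $X_j>u_j$ for at least one $j\in J$. If $\gamma=0$, $(1+\gamma x)^{-1/\gamma}$ is read as $e^{-x}$. A function $\ell:[0,\infty)^d\to[0,\infty)$ is a stable tail dependence function (stdf) if there is a random vector $V$ with values in $[0,\infty)^d$ and $\mathbb E[V_j]=1$ for all $j$ such that $\ell(y)=\mathbb E[\max_{j}(y_jV_j)]$ for all $y\in[0,\infty)^d$. For $\varnothing\neq J\subset\{1,\dots,d\}$, $\ell_J:[0,\infty)^J\to[0,\infty)$ is the ($|J|$-variate) stdf $\ell_J(y)=\ell(\sum_{j\in J}y_je_j)$, where $e_1,\dots,e_d$ are the canonical unit vectors of $\mathbb R^d$. For $\sigma\in(0,\infty)^d$, $\gamma\in\mathbb R^d$, $\pi\in(0,1]^d$ and a stdf $\ell$ with $\ell(\pi)=1$, put $\eta_j=-\sigma_j/\gamma_j$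 if $\gamma_j>0$ and $\eta_j=-\infty$ if $\gamma_j\le 0$. $\operatorname{GP}(\sigma,\gamma,\pi,\ell)$ is the probability distribution concentrated on $\{x\in[-\infty,\infty)^d:x\ge\eta,\ x_j>0\text{ for some }j\}$ whose cdf $H$ satisfies $H(x)=\ell\{\pi(1+\gamma\tfrac{x\wedge 0}{\sigma})^{-1/\gamma}\}-\ell\{\pi(1+\gamma\tfrac{x}{\sigma})^{-1/\gamma}\}$ for all $x\in\mathbb R^d$ with $\sigma_j+\gamma_jx_j>0$ for all $j$. The same definition is used with index set $J$ in place of $\{1,\dots,d\}$. *)

theory Defs
  imports "HOL-Probability.Probability"
begin

text \<open>
  Vectors indexed by a finite set \<open>I\<close> are functions on \<open>I\<close>.  A function \<open>l\<close> on
  \<open>[0,\<infinity>)\<^sup>I\<close> is only ever evaluated on \<open>I \<rightarrow>\<^sub>E {0..}\<close>.  The random vector \<open>V\<close> enters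
  the definition only through its law \<open>N\<close>.
\<close>

definition is_stdf :: "'i set \<Rightarrow> (('i \<Rightarrow> real) \<Rightarrow> real) \<Rightarrow> bool" where
  "is_stdf I l \<longleftrightarrow>
     (\<exists>N :: ('i \<Rightarrow> real) measure.
        prob_space N \<and>
        sets N = sets (Pi\<^sub>M I (\<lambda>_. borel)) \<and>
        (AE v in N. \<forall>j\<in>I. 0 \<le> v j) \<and>
        (\<forall>j\<in>I. integrable N (\<lambda>v. v j) \<and> (\<integral>v. v j \<partial>N) = 1) \<and>
        (\<forall>y \<in> I \<rightarrow>\<^sub>E {0..}. l y = (\<integral>v. Max ((\<lambda>j. y j * v j) ` I) \<partial>N)))"

definition stdf_margin :: "'i set \<Rightarrow> 'i set \<Rightarrow> (('i \<Rightarrow> real) \<Rightarrow> real) \<Rightarrow> ('i \<Rightarrow> real) \<Rightarrow> real" where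
  "stdf_margin I J l y = l (\<lambda>j\<in>I. if j \<in> J then y j else 0)"

definition gp_pow :: "real \<Rightarrow> real \<Rightarrow> real" where
  "gp_pow \<gamma> z = (if \<gamma> = 0 then exp (- z) else (1 + \<gamma> * z) powr (- 1 / \<gamma>))"

definition gp_lower :: "real \<Rightarrow> real \<Rightarrow> ereal" where
  "gp_lower \<sigma> \<gamma> = (if \<gamma> > 0 then ereal (- \<sigma> / \<gamma>) else - \<infinity>)"

text \<open>
  \<open>is_GP I \<sigma> \<gamma> \<pi> l \<mu>\<close>: the parameters are admissible and \<open>\<mu>\<close>, a law on the Borel sets of
  \<open>[-\<infinity>,\<infinity>]\<^sup>I\<close> giving no mass to the value \<open>\<infinity>\<close>, is the distribution \<open>GP(\<sigma>,\<gamma>,\<pi>,l)\<close>.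
\<close>

definition is_GP ::
  "'i set \<Rightarrow> ('i \<Rightarrow> real) \<Rightarrow> ('i \<Rightarrow> real) \<Rightarrow> ('i \<Rightarrow> real) \<Rightarrow> (('i \<Rightarrow> real) \<Rightarrow> real) \<Rightarrow>
   ('i \<Rightarrow> ereal) measure \<Rightarrow> bool" where
  "is_GP I \<sigma> \<gamma> \<pi> l \<mu> \<longleftrightarrow>
     (\<forall>j\<in>I. 0 < \<sigma> j) \<and> (\<forall>j\<in>I. 0 < \<pi> j \<and> \<pi> j \<le> 1) \<and>
     is_stdf I l \<and> l (restrict \<pi> I) = 1 \<and>
     prob_space \<mu> \<and> sets \<mu> = sets (Pi\<^sub>M I (\<lambda>_. borel)) \<and>
     (AE x in \<mu>. (\<forall>j\<in>I. x j < \<infinity> \<and> gp_lower (\<sigma> j) (\<gamma> j) \<le> x j) \<and> (\<exists>j\<in>I. 0 < x j)) \<and>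
     (\<forall>x :: 'i \<Rightarrow> real. (\<forall>j\<in>I. 0 < \<sigma> j + \<gamma> j * x j) \<longrightarrow>
        measure \<mu> {z \<in> space \<mu>. \<forall>j\<in>I. z j \<le> ereal (x j)} =
          l (\<lambda>j\<in>I. \<pi> j * gp_pow (\<gamma> j) (min (x j) 0 / \<sigma> j)) -
          l (\<lambda>j\<in>I. \<pi> j * gp_pow (\<gamma> j) (x j / \<sigma> j)))"

end

theory Submission
  imports Defs "HOL-Real_Asymp.Real_Asymp"
begin

text \<open>
  Letting the thresholds outside \<open>J\<close> tend to their upper endpoints shows that
  \<open>Pr[X\<^sub>J \<le> x]\<close> is a term depending only on \<open>x \<and> 0\<close> minus
  \<open>l\<^sub>J(\<pi>(1 + \<gamma> x/\<sigma>)^(-1/\<gamma>))\<close>.  Taking \<open>x = u\<close>, also for singletons \<open>J\<close>, gives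
  \<open>Pr[X\<^sub>j > u\<^sub>j] = y\<^sub>j\<close> and \<open>Pr[\<not> X\<^sub>J \<le> u] = l\<^sub>J(y)\<close> for \<open>y = \<pi>(1 + \<gamma> u/\<sigma>)^(-1/\<gamma>)\<close>.
  Since \<open>{X\<^sub>J \<le> x + u, \<not> X\<^sub>J \<le> u}\<close> is \<open>{X\<^sub>J \<le> x + u}\<close> minus \<open>{X\<^sub>J \<le> (x \<and> 0) + u}\<close>, the first
  terms of the two margins cancel; what remains factors through
  \<open>\<sigma> + \<gamma>(x + u) = (\<sigma> + \<gamma>u) + \<gamma>x\<close> and the homogeneity of \<open>l\<^sub>J\<close>.
\<close>

section \<open>Stable tail dependence functions\<close>

text \<open>Each \<open>f j\<close> exceeds \<open>g j\<close> by at most the total l1 distance.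
  This is the pointwise source of the Lipschitz bound for stdfs.\<close>

lemma Max_image_le_Max_add_sum:
  fixes f g :: "'i \<Rightarrow> real"
  assumes "finite I" "I \<noteq> {}"
  shows "Max (f ` I) \<le> Max (g ` I) + (\<Sum>j\<in>I. \<bar>f j - g j\<bar>)"
proof -
  have "f j \<le> Max (g ` I) + (\<Sum>j\<in>I. \<bar>f j - g j\<bar>)" if "j \<in> I" for j
  proof -
    have "g j \<le> Max (g ` I)" using assms that by simp
    moreover have "\<bar>f j - g j\<bar> \<le> (\<Sum>j\<in>I. \<bar>f j - g j\<bar>)"
      using assms that by (intro member_le_sum) auto
    ultimately show ?thesis by linarith
  qed
  then show ?thesis using assms by simp
qed

text \<open>Integrate the pointwise bound on maxima: V is almost surely nonnegative and each V_j has
  mean 1, so the l1 distance survives with constant 1.\<close>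

lemma is_stdf_le_add_sum:
  assumes l: "is_stdf I l" and I: "finite I" "I \<noteq> {}"
    and y: "y \<in> I \<rightarrow>\<^sub>E {0..}" "y' \<in> I \<rightarrow>\<^sub>E {0..}"
  shows "l y \<le> l y' + (\<Sum>j\<in>I. \<bar>y j - y' j\<bar>)"
proof -
  obtain N where N: "AE v in N. \<forall>j\<in>I. 0 \<le> v j"
      "\<And>j. j \<in> I \<Longrightarrow> integrable N (\<lambda>v. v j)" "\<And>j. j \<in> I \<Longrightarrow> (\<integral>v. v j \<partial>N) = 1"
      "\<And>y. y \<in> I \<rightarrow>\<^sub>E {0..} \<Longrightarrow> l y = (\<integral>v. Max ((\<lambda>j. y j * v j) ` I) \<partial>N)"
    using l unfolding is_stdf_def by blast
  have int: "integrable N (\<lambda>v. Max ((\<lambda>j. y j * v j) ` I))" for y :: "'a \<Rightarrow> real"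
    using I N(2) by (intro integrable_MAX) auto
  have "l y = (\<integral>v. Max ((\<lambda>j. y j * v j) ` I) \<partial>N)" using N(4) y by simp
  also have "\<dots> \<le> (\<integral>v. Max ((\<lambda>j. y' j * v j) ` I) + (\<Sum>j\<in>I. \<bar>y j - y' j\<bar> * v j) \<partial>N)"
  proof (rule integral_mono_AE)
    show "integrable N (\<lambda>v. Max ((\<lambda>j. y' j * v j) ` I) + (\<Sum>j\<in>I. \<bar>y j - y' j\<bar> * v j))"
      using int N(2) by auto
    show "AE v in N. Max ((\<lambda>j. y j * v j) ` I) \<le>
        Max ((\<lambda>j. y' j * v j) ` I) + (\<Sum>j\<in>I. \<bar>y j - y' j\<bar> * v j)"
      using N(1)
    proof eventually_elim
      case (elim v)
      have "(\<Sum>j\<in>I. \<bar>y j * v j - y' j * v j\<bar>) = (\<Sum>j\<in>I. \<bar>y j - y' j\<bar> * v j)"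
        using elim by (intro sum.cong refl) (simp flip: left_diff_distrib add: abs_mult)
      then show ?case
        using Max_image_le_Max_add_sum[OF I, of "\<lambda>j. y j * v j" "\<lambda>j. y' j * v j"] by simp
    qed
  qed (rule int)
  also have "\<dots> = (\<integral>v. Max ((\<lambda>j. y' j * v j) ` I) \<partial>N) + (\<Sum>j\<in>I. \<bar>y j - y' j\<bar>)"
    using int N(2,3) by (simp add: Bochner_Integration.integral_add)
  finally show ?thesis using N(4) y by simp
qed

text \<open>Lipschitz bounds in both directions squeeze the difference. This continuity later lets
  the coordinates outside J tend to 0.\<close>

lemma is_stdf_tendsto:
  assumes l: "is_stdf I l" and I: "finite I" "I \<noteq> {}"
    and y: "\<And>n. y n \<in> I \<rightarrow>\<^sub>E {0..}" "z \<in> I \<rightarrow>\<^sub>E {0..}"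
    and lim: "\<And>j. j \<in> I \<Longrightarrow> (\<lambda>n. y n j) \<longlonglongrightarrow> z j"
  shows "(\<lambda>n::nat. l (y n)) \<longlonglongrightarrow> l z"
proof (rule Lim_null_comparison[THEN LIM_zero_cancel])
  have "\<bar>l (y n) - l z\<bar> \<le> (\<Sum>j\<in>I. \<bar>y n j - z j\<bar>)" for n
    using is_stdf_le_add_sum[OF l I y(1,2), of n] is_stdf_le_add_sum[OF l I y(2,1), of n]
    by (simp add: abs_minus_commute)
  then show "\<forall>\<^sub>F n in sequentially. norm (l (y n) - l z) \<le> (\<Sum>j\<in>I. \<bar>y n j - z j\<bar>)"
    by simp
  have "(\<lambda>n. \<bar>y n j - z j\<bar>) \<longlonglongrightarrow> 0" if "j \<in> I" for j
    using lim[OF that] by (simp add: LIM_zero tendsto_rabs_zero)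
  then show "(\<lambda>n. \<Sum>j\<in>I. \<bar>y n j - z j\<bar>) \<longlonglongrightarrow> 0"
    by (intro tendsto_null_sum)
qed

text \<open>Multiplication by c >= 0 is monotone, so it passes through the maximum and then the
  integral. It is used with c the reciprocal of the probability of the conditioning event.\<close>

lemma is_stdf_mult:
  assumes l: "is_stdf I l" and I: "finite I" "I \<noteq> {}"
    and y: "y \<in> I \<rightarrow>\<^sub>E {0..}" and c: "0 \<le> c"
  shows "l (\<lambda>j\<in>I. c * y j) = c * l y"
proof -
  obtain N where N:
      "\<And>y. y \<in> I \<rightarrow>\<^sub>E {0..} \<Longrightarrow> l y = (\<integral>v. Max ((\<lambda>j. y j * v j) ` I) \<partial>N)"
    using l unfolding is_stdf_def by blast
  have cy: "(\<lambda>j\<in>I. c * y j) \<in> I \<rightarrow>\<^sub>E {0..}"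
    using y c by (auto simp: PiE_iff)
  have "Max ((\<lambda>j. (\<lambda>j\<in>I. c * y j) j * v j) ` I) = c * Max ((\<lambda>j. y j * v j) ` I)" for v
  proof -
    have "mono ((*) c)" using c by (auto intro!: monoI mult_left_mono)
    then have "c * Max ((\<lambda>j. y j * v j) ` I) = Max ((*) c ` ((\<lambda>j. y j * v j) ` I))"
      using I by (intro mono_Max_commute) auto
    also have "(*) c ` ((\<lambda>j. y j * v j) ` I) = (\<lambda>j. (\<lambda>j\<in>I. c * y j) j * v j) ` I"
      by (auto simp: image_image mult.assoc intro!: image_cong)
    finally show ?thesis by simp
  qed
  then show ?thesis
    unfolding N[OF y] N[OF cy] by simp
qed

text \<open>As V is almost surely nonnegative, the maximum reduces to coordinate k, whose mean is 1.
  This later evaluates the exceedance probability of a single coordinate.\<close>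

lemma is_stdf_unit:
  assumes l: "is_stdf I l" and I: "finite I" and k: "k \<in> I" and c: "0 \<le> c"
  shows "l (\<lambda>j\<in>I. if j = k then c else 0) = c"
proof -
  obtain N where N: "AE v in N. \<forall>j\<in>I. 0 \<le> v j"
      "\<And>j. j \<in> I \<Longrightarrow> integrable N (\<lambda>v. v j)" "\<And>j. j \<in> I \<Longrightarrow> (\<integral>v. v j \<partial>N) = 1"
      "\<And>y. y \<in> I \<rightarrow>\<^sub>E {0..} \<Longrightarrow> l y = (\<integral>v. Max ((\<lambda>j. y j * v j) ` I) \<partial>N)"
    using l unfolding is_stdf_def by blast
  let ?y = "\<lambda>j\<in>I. if j = k then c else 0"
  have "l ?y = (\<integral>v. Max ((\<lambda>j. ?y j * v j) ` I) \<partial>N)"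
    using c by (intro N(4)) auto
  also have "\<dots> = (\<integral>v. c * v k \<partial>N)"
  proof (rule integral_cong_AE)
    have "integrable N (\<lambda>v. Max ((\<lambda>j. ?y j * v j) ` I))"
      using I k N(2) by (intro integrable_MAX) auto
    then show "(\<lambda>v. Max ((\<lambda>j. ?y j * v j) ` I)) \<in> borel_measurable N" by auto
    show "(\<lambda>v. c * v k) \<in> borel_measurable N"
      using N(2)[OF k] by auto
    show "AE v in N. Max ((\<lambda>j. ?y j * v j) ` I) = c * v k"
      using N(1) by eventually_elim (use I k c in \<open>auto intro!: Max_eqI\<close>)
  qed
  also have "\<dots> = c" using N(2,3)[OF k] by simp
  finally show ?thesis .
qed

lemma is_stdf_zero:
  assumes "is_stdf I l" "finite I" "I \<noteq> {}"
  shows "l (\<lambda>j\<in>I. 0) = 0"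
proof -
  obtain k where "k \<in> I" using assms by blast
  then show ?thesis using is_stdf_unit[of I l k 0] assms by simp
qed

text \<open>The representing law is the marginal law of V on J.\<close>

lemma is_stdf_stdf_margin:
  assumes l: "is_stdf I l" and I: "finite I" and J: "J \<noteq> {}" "J \<subseteq> I"
  shows "is_stdf J (stdf_margin I J l)"
proof -
  obtain N where N: "prob_space N" "sets N = sets (Pi\<^sub>M I (\<lambda>_. borel))"
      "AE v in N. \<forall>j\<in>I. 0 \<le> v j"
      "\<And>j. j \<in> I \<Longrightarrow> integrable N (\<lambda>v. v j)" "\<And>j. j \<in> I \<Longrightarrow> (\<integral>v. v j \<partial>N) = 1"
      "\<And>y. y \<in> I \<rightarrow>\<^sub>E {0..} \<Longrightarrow> l y = (\<integral>v. Max ((\<lambda>j. y j * v j) ` I) \<partial>N)"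
    using l unfolding is_stdf_def by blast
  have finJ: "finite J" using I J finite_subset by blast
  have R[measurable]: "(\<lambda>v. restrict v J) \<in> N \<rightarrow>\<^sub>M Pi\<^sub>M J (\<lambda>_. borel)"
    using measurable_restrict_subset[OF J(2), of "\<lambda>_. borel"] N(2)
    by (simp cong: measurable_cong_sets)
  let ?N = "distr N (Pi\<^sub>M J (\<lambda>_. borel)) (\<lambda>v. restrict v J)"
  have margin: "stdf_margin I J l y = (\<integral>v. Max ((\<lambda>j. y j * v j) ` J) \<partial>?N)"
    if y: "y \<in> J \<rightarrow>\<^sub>E {0..}" for y
  proof -
    let ?y = "\<lambda>j\<in>I. if j \<in> J then y j else 0"
    have "stdf_margin I J l y = (\<integral>v. Max ((\<lambda>j. ?y j * v j) ` I) \<partial>N)"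
      unfolding stdf_margin_def using y by (intro N(6)) auto
    also have "\<dots> = (\<integral>v. Max ((\<lambda>j. y j * restrict v J j) ` J) \<partial>N)"
    proof (rule integral_cong_AE)
      have "integrable N (\<lambda>v. Max ((\<lambda>j. ?y j * v j) ` I))"
        using I J N(4) by (intro integrable_MAX) auto
      then show "(\<lambda>v. Max ((\<lambda>j. ?y j * v j) ` I)) \<in> borel_measurable N" by auto
      show "(\<lambda>v. Max ((\<lambda>j. y j * restrict v J j) ` J)) \<in> borel_measurable N"
        using finJ by measurable
      show "AE v in N. Max ((\<lambda>j. ?y j * v j) ` I) = Max ((\<lambda>j. y j * restrict v J j) ` J)"
        using N(3)
      proof eventually_elim
        case (elim v)
        let ?m = "Max ((\<lambda>j. y j * restrict v J j) ` J)"
        have le: "y j * v j \<le> ?m" if "j \<in> J" for j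
          using finJ that by (auto intro!: Max_ge)
        \<comment> \<open>A nonempty J supplies one nonnegative product, so the zeros contributed by
          I - J cannot raise the maximum.\<close>
        obtain k where k: "k \<in> J" using J by blast
        have "0 \<le> y k * v k" using elim k J y by (auto simp: PiE_iff)
        then have m0: "0 \<le> ?m" using le[OF k] by simp
        have "?m \<in> (\<lambda>j. y j * restrict v J j) ` J"
          using finJ J by (intro Max_in) auto
        then have "?m \<in> (\<lambda>j. ?y j * v j) ` I"
          using J by (force simp: image_iff)
        then show ?case
          using I le m0 by (intro Max_eqI) auto
      qed
    qed
    also have "\<dots> = (\<integral>v. Max ((\<lambda>j. y j * v j) ` J) \<partial>?N)"
      using finJ by (subst integral_distr[OF R]) auto
    finally show ?thesis .
  qed
  show ?thesis
    unfolding is_stdf_def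
  proof (intro exI[of _ ?N] conjI ballI)
    show "prob_space ?N" using N(1) R by (rule prob_space.prob_space_distr)
    have "AE v in N. \<forall>j\<in>J. 0 \<le> restrict v J j"
      using N(3) by eventually_elim (use J in auto)
    then show "AE v in ?N. \<forall>j\<in>J. 0 \<le> v j"
      using finJ by (subst AE_distr_iff[OF R]) auto
    fix j assume j: "j \<in> J"
    then have "(\<lambda>v. restrict v J j) = (\<lambda>v. v j)" by auto
    then show "integrable ?N (\<lambda>v. v j)" "(\<integral>v. v j \<partial>?N) = 1"
      using N(4,5)[of j] j J by (auto simp: integrable_distr_eq integral_distr)
  qed (use margin in auto)
qed

section \<open>The margins of a generalized Pareto distribution\<close>

lemma gp_pow_nonneg: "0 \<le> gp_pow \<gamma> z"
  by (simp add: gp_pow_def)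

lemma gp_pow_0: "gp_pow \<gamma> 0 = 1"
  by (simp add: gp_pow_def)

text \<open>The base factors as (1 + \<gamma> u/\<sigma>)(1 + \<gamma> x/(\<sigma> + \<gamma> u)),
  which is where the new scale comes from; for \<gamma> = 0 the exponents add.\<close>

lemma gp_pow_add:
  assumes "0 < \<sigma>" "0 < \<sigma> + \<gamma> * u" "0 < \<sigma> + \<gamma> * u + \<gamma> * x"
  shows "gp_pow \<gamma> ((x + u) / \<sigma>) = gp_pow \<gamma> (u / \<sigma>) * gp_pow \<gamma> (x / (\<sigma> + \<gamma> * u))"
proof (cases "\<gamma> = 0")
  case True
  then show ?thesis by (simp add: gp_pow_def add_divide_distrib flip: exp_add)
next
  case False
  have 1: "1 + \<gamma> * ((x + u) / \<sigma>) = (1 + \<gamma> * (u / \<sigma>)) * (1 + \<gamma> * (x / (\<sigma> + \<gamma> * u)))"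
    using assms by (simp add: divide_simps) (simp add: algebra_simps)
  have 2: "1 + \<gamma> * (u / \<sigma>) = (\<sigma> + \<gamma> * u) / \<sigma>"
      "1 + \<gamma> * (x / (\<sigma> + \<gamma> * u)) = (\<sigma> + \<gamma> * u + \<gamma> * x) / (\<sigma> + \<gamma> * u)"
    using assms by (simp_all add: divide_simps)
  have "0 \<le> 1 + \<gamma> * (u / \<sigma>)" "0 \<le> 1 + \<gamma> * (x / (\<sigma> + \<gamma> * u))"
    unfolding 2 using assms by simp_all
  then show ?thesis
    using False by (simp only: gp_pow_def 1 powr_mult if_False)
qed

lemma gp_pow_pos: "0 < \<sigma> \<Longrightarrow> 0 < \<sigma> + \<gamma> * u \<Longrightarrow> 0 < gp_pow \<gamma> (u / \<sigma>)"
proof -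
  assume "0 < \<sigma>" "0 < \<sigma> + \<gamma> * u"
  \<comment> \<open>In HOL, \<open>0 powr a\<close> is 0 and every other base gives a positive
    power, so a nonzero base suffices.\<close>
  then have "1 + \<gamma> * (u / \<sigma>) \<noteq> 0" by (simp add: divide_simps)
  then show ?thesis by (simp add: gp_pow_def)
qed

text \<open>A sequence increasing to the upper endpoint of a univariate generalized Pareto law.\<close>

definition gp_approx :: "real \<Rightarrow> real \<Rightarrow> nat \<Rightarrow> real" where
  "gp_approx \<sigma> \<gamma> n = (if \<gamma> < 0 then \<sigma> / (- \<gamma>) * (1 - 1 / (real n + 1)) else real n)"

lemma gp_approx_nonneg: "0 < \<sigma> \<Longrightarrow> 0 \<le> gp_approx \<sigma> \<gamma> n"
  by (simp add: gp_approx_def mult_nonneg_nonpos divide_nonneg_neg)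

text \<open>Keeps the thresholds where the cdf formula applies: for \<gamma> < 0 the factor 1 -
  1/(n+1) leaves the slack \<sigma>/(n+1).\<close>

lemma gp_approx_pos:
  assumes "0 < \<sigma>" shows "0 < \<sigma> + \<gamma> * gp_approx \<sigma> \<gamma> n"
proof (cases "\<gamma> < 0")
  case True
  then have "\<sigma> + \<gamma> * gp_approx \<sigma> \<gamma> n = \<sigma> / (real n + 1)"
    by (simp add: gp_approx_def divide_simps) (simp add: algebra_simps)
  then show ?thesis using assms by simp
qed (use assms in \<open>simp add: gp_approx_def add_pos_nonneg\<close>)

lemma gp_approx_mono:
  assumes "0 < \<sigma>" "m \<le> n" shows "gp_approx \<sigma> \<gamma> m \<le> gp_approx \<sigma> \<gamma> n"
proof (cases "\<gamma> < 0")
  case True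
  have "1 / (real n + 1) \<le> 1 / (real m + 1)"
    using assms by (intro divide_left_mono) auto
  moreover have "0 \<le> \<sigma> / (- \<gamma>)" using assms True by (intro divide_nonneg_nonneg) auto
  ultimately show ?thesis
    using True unfolding gp_approx_def by (simp only: if_True) (intro mult_left_mono, auto)
qed (use assms in \<open>simp add: gp_approx_def\<close>)

text \<open>For \<gamma> < 0 the base is exactly 1/(n+1) with a positive exponent; for \<gamma> = 0
  the decay is exponential; for \<gamma> > 0 a growing base has a negative exponent.\<close>

lemma gp_pow_gp_approx_tendsto:
  assumes "0 < \<sigma>"
  shows "(\<lambda>n. gp_pow \<gamma> (gp_approx \<sigma> \<gamma> n / \<sigma>)) \<longlonglongrightarrow> 0"
proof -
  consider "\<gamma> < 0" | "\<gamma> = 0" | "\<gamma> > 0" by linarith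
  then show ?thesis
  proof cases
    case 1
    then have "gp_pow \<gamma> (gp_approx \<sigma> \<gamma> n / \<sigma>) = (1 / (real n + 1)) powr (- 1 / \<gamma>)" for n
      using assms by (simp add: gp_pow_def gp_approx_def divide_simps)
    moreover have "(\<lambda>n. (1 / (real n + 1)) powr (- 1 / \<gamma>)) \<longlonglongrightarrow> 0"
      using 1 by real_asymp
    ultimately show ?thesis by simp
  next
    case 2
    have "(\<lambda>n. exp (- (real n / \<sigma>))) \<longlonglongrightarrow> 0"
      using assms by real_asymp
    then show ?thesis using 2 by (simp add: gp_pow_def gp_approx_def)
  next
    case 3
    have "(\<lambda>n. (1 + \<gamma> * (real n / \<sigma>)) powr (- 1 / \<gamma>)) \<longlonglongrightarrow> 0"
      using assms 3 by real_asymp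
    then show ?thesis using 3 by (simp add: gp_pow_def gp_approx_def)
  qed
qed


text \<open>Thresholds outside \<open>J\<close> tend to their upper endpoints, which gives the law of the
  \<open>J\<close>-margin up to the event that some coordinate sits at or above its endpoint.\<close>

lemma is_GP_measure_UN:
  assumes GP: "is_GP I \<sigma> \<gamma> \<pi> l \<mu>" and I: "finite I" "I \<noteq> {}"
    and x: "\<And>j. j \<in> J \<Longrightarrow> 0 < \<sigma> j + \<gamma> j * x j"
  shows "measure \<mu> (\<Union>n. {z \<in> space \<mu>. \<forall>j\<in>I.
      z j \<le> ereal (if j \<in> J then x j else gp_approx (\<sigma> j) (\<gamma> j) n)}) =
    l (\<lambda>j\<in>I. \<pi> j * (if j \<in> J then gp_pow (\<gamma> j) (min (x j) 0 / \<sigma> j) else 1)) -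
    stdf_margin I J l (\<lambda>j. \<pi> j * gp_pow (\<gamma> j) (x j / \<sigma> j))"
proof -
  have \<sigma>: "\<And>j. j \<in> I \<Longrightarrow> 0 < \<sigma> j" and \<pi>: "\<And>j. j \<in> I \<Longrightarrow> 0 < \<pi> j"
    and l: "is_stdf I l" and ps: "prob_space \<mu>"
    and [measurable_cong]: "sets \<mu> = sets (Pi\<^sub>M I (\<lambda>_. borel))"
    and cdf: "\<And>x. (\<forall>j\<in>I. 0 < \<sigma> j + \<gamma> j * x j) \<Longrightarrow>
        measure \<mu> {z \<in> space \<mu>. \<forall>j\<in>I. z j \<le> ereal (x j)} =
          l (\<lambda>j\<in>I. \<pi> j * gp_pow (\<gamma> j) (min (x j) 0 / \<sigma> j)) -
          l (\<lambda>j\<in>I. \<pi> j * gp_pow (\<gamma> j) (x j / \<sigma> j))"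
    using GP unfolding is_GP_def by auto
  interpret prob_space \<mu> by (rule ps)
  define t where "t n j = (if j \<in> J then x j else gp_approx (\<sigma> j) (\<gamma> j) n)" for n j
  define A where "A n = {z \<in> space \<mu>. \<forall>j\<in>I. z j \<le> ereal (t n j)}" for n
  define y where "y = (\<lambda>j\<in>I. \<pi> j * (if j \<in> J then gp_pow (\<gamma> j) (min (x j) 0 / \<sigma> j) else 1))"
  define w where "w n = (\<lambda>j\<in>I. \<pi> j * gp_pow (\<gamma> j) (t n j / \<sigma> j))" for n
  define w' where "w' = (\<lambda>j\<in>I. if j \<in> J then \<pi> j * gp_pow (\<gamma> j) (x j / \<sigma> j) else 0)"
  have sets_A: "range A \<subseteq> sets \<mu>" using I by (auto simp: A_def)
  have "incseq A"
  proof (rule incseq_SucI, rule subsetI)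
    fix n z assume z: "z \<in> A n"
    have "ereal (t n j) \<le> ereal (t (Suc n) j)" if "j \<in> I" for j
      using gp_approx_mono[OF \<sigma>[OF that], of n "Suc n"] by (simp add: t_def)
    then show "z \<in> A (Suc n)" using z order_trans unfolding A_def by blast
  qed
  then have "(\<lambda>n. prob (A n)) \<longlonglongrightarrow> prob (\<Union>n. A n)"
    by (rule finite_Lim_measure_incseq[OF sets_A])
  moreover have "(\<lambda>n. prob (A n)) \<longlonglongrightarrow> l y - l w'"
  proof -
    \<comment> \<open>Thresholds outside J are nonnegative, so their minimum with 0 is 0 and the
      power is 1: the first term of the cdf does not depend on n.\<close>
    have "(\<lambda>j\<in>I. \<pi> j * gp_pow (\<gamma> j) (min (t n j) 0 / \<sigma> j)) = y" for n
      using gp_approx_nonneg[OF \<sigma>] by (auto simp: t_def y_def min_absorb2 gp_pow_0)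
    moreover have "0 < \<sigma> j + \<gamma> j * t n j" if "j \<in> I" for j n
      using x gp_approx_pos[OF \<sigma>[OF that]] by (simp add: t_def)
    ultimately have "prob (A n) = l y - l (w n)" for n
      unfolding A_def w_def by (subst cdf) auto
    moreover have "(\<lambda>n. l (w n)) \<longlonglongrightarrow> l w'"
    proof (rule is_stdf_tendsto[OF l I])
      show "w n \<in> I \<rightarrow>\<^sub>E {0..}" for n
        using \<pi> by (auto simp: w_def PiE_iff gp_pow_nonneg less_imp_le)
      show "w' \<in> I \<rightarrow>\<^sub>E {0..}"
        using \<pi> by (auto simp: w'_def PiE_iff gp_pow_nonneg less_imp_le)
      \<comment> \<open>Constant in n on J; outside J the powers decay to 0, which turns l into its
        margin.\<close>
      show "(\<lambda>n. w n j) \<longlonglongrightarrow> w' j" if "j \<in> I" for j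
        using that tendsto_mult_right_zero[OF gp_pow_gp_approx_tendsto[OF \<sigma>[OF that]]]
        by (cases "j \<in> J") (simp_all add: w_def w'_def t_def)
    qed
    ultimately show ?thesis by (simp add: tendsto_diff)
  qed
  ultimately have "prob (\<Union>n. A n) = l y - l w'" by (rule LIMSEQ_unique)
  then show ?thesis unfolding A_def t_def y_def w'_def stdf_margin_def .
qed

text \<open>With the empty set as J, the preceding formula gives l(\<pi>) - l(0) = 1. For \<gamma> <
  0 the thresholds stay below \<sigma>/(-\<gamma>), so the upper endpoint is deduced here from the
  cdf and l(\<pi>) = 1.\<close>

lemma is_GP_AE_le_gp_approx:
  assumes GP: "is_GP I \<sigma> \<gamma> \<pi> l \<mu>" and I: "finite I" "I \<noteq> {}"
  shows "AE z in \<mu>. \<exists>n. \<forall>j\<in>I. z j \<le> ereal (gp_approx (\<sigma> j) (\<gamma> j) n)"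
proof -
  have l: "is_stdf I l" and l1: "l (restrict \<pi> I) = 1" and ps: "prob_space \<mu>"
    using GP unfolding is_GP_def by auto
  have "measure \<mu> (\<Union>n. {z \<in> space \<mu>. \<forall>j\<in>I. z j \<le> ereal (gp_approx (\<sigma> j) (\<gamma> j) n)}) = 1"
    using is_GP_measure_UN[OF GP I, of "{}" "\<lambda>_. 0"] is_stdf_zero[OF l I] l1
    by (simp add: stdf_margin_def)
  from prob_space.AE_prob_1[OF ps this] show ?thesis
    by eventually_elim auto
qed

text \<open>Almost every point lies below some common threshold index, so the margin event equals
  the increasing union up to a null set.\<close>

lemma is_GP_margin_cdf:
  assumes GP: "is_GP I \<sigma> \<gamma> \<pi> l \<mu>" and I: "finite I" "I \<noteq> {}" and J: "J \<subseteq> I"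
    and x: "\<And>j. j \<in> J \<Longrightarrow> 0 < \<sigma> j + \<gamma> j * x j"
  shows "measure \<mu> {z \<in> space \<mu>. \<forall>j\<in>J. z j \<le> ereal (x j)} =
    l (\<lambda>j\<in>I. \<pi> j * (if j \<in> J then gp_pow (\<gamma> j) (min (x j) 0 / \<sigma> j) else 1)) -
    stdf_margin I J l (\<lambda>j. \<pi> j * gp_pow (\<gamma> j) (x j / \<sigma> j))"
proof -
  have ps: "prob_space \<mu>" and [measurable_cong]: "sets \<mu> = sets (Pi\<^sub>M I (\<lambda>_. borel))"
    using GP unfolding is_GP_def by auto
  interpret prob_space \<mu> by (rule ps)
  have finJ: "finite J" using I J finite_subset by blast
  have JI: "j \<in> J \<Longrightarrow> j \<in> I" for j using J by blast
  let ?A = "\<lambda>n. {z \<in> space \<mu>. \<forall>j\<in>I. z j \<le> ereal (if j \<in> J then x j else gp_approx (\<sigma> j) (\<gamma> j) n)}"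
  let ?B = "{z \<in> space \<mu>. \<forall>j\<in>J. z j \<le> ereal (x j)}"
  have "prob ?B = prob (\<Union>n. ?A n)"
  proof (rule finite_measure_eq_AE)
    show "AE z in \<mu>. z \<in> ?B \<longleftrightarrow> z \<in> (\<Union>n. ?A n)"
      using is_GP_AE_le_gp_approx[OF GP I]
    proof eventually_elim
      case (elim z)
      then obtain n where n: "\<And>j. j \<in> I \<Longrightarrow> z j \<le> ereal (gp_approx (\<sigma> j) (\<gamma> j) n)" by blast
      show ?case
      proof
        assume "z \<in> ?B"
        then have "z \<in> ?A n" using n by auto
        then show "z \<in> (\<Union>n. ?A n)" by blast
      next
        assume "z \<in> (\<Union>n. ?A n)"
        then show "z \<in> ?B" using JI by fastforce
      qed
    qed
    show "?B \<in> sets \<mu>" using finJ JI by measurable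
    have "?A n \<in> sets \<mu>" for n using I by measurable
    then show "(\<Union>n. ?A n) \<in> sets \<mu>" by blast
  qed
  then show ?thesis using is_GP_measure_UN[OF GP I, of J x] x by simp
qed

section \<open>Threshold exceedances\<close>

theorem proposition8p1:
  fixes M :: "'a measure" and X :: "'a \<Rightarrow> nat \<Rightarrow> ereal"
    and d :: nat and J :: "nat set"
    and \<sigma> \<gamma> \<pi> u :: "nat \<Rightarrow> real" and l :: "(nat \<Rightarrow> real) \<Rightarrow> real"
  assumes "prob_space M"
    and "X \<in> M \<rightarrow>\<^sub>M Pi\<^sub>M {1..d} (\<lambda>_. borel)"
    and "is_GP {1..d} \<sigma> \<gamma> \<pi> l (distr M (Pi\<^sub>M {1..d} (\<lambda>_. borel)) X)"
    and "J \<noteq> {}" and "J \<subseteq> {1..d}"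
    and "\<forall>j\<in>J. 0 \<le> u j"
    and "\<forall>j\<in>J. 0 < \<P>(\<omega> in M. ereal (u j) < X \<omega> j)"
  shows "is_GP J
    (\<lambda>j. \<sigma> j + \<gamma> j * u j)
    \<gamma>
    (\<lambda>j. \<P>(\<omega> in M. ereal (u j) < X \<omega> j \<bar> \<exists>k\<in>J. ereal (u k) < X \<omega> k))
    (stdf_margin {1..d} J l)
    (distr (uniform_measure M {\<omega> \<in> space M. \<exists>k\<in>J. ereal (u k) < X \<omega> k})
       (Pi\<^sub>M J (\<lambda>_. borel))
       (\<lambda>\<omega>. \<lambda>j\<in>J. X \<omega> j - ereal (u j)))"
proof -
  define I where "I = {1..d}"
  define \<mu> where "\<mu> = distr M (Pi\<^sub>M I (\<lambda>_. borel)) X"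
  define L where "L = stdf_margin I J l"
  define A where "A = {\<omega> \<in> space M. \<exists>k\<in>J. ereal (u k) < X \<omega> k}"
  define Y where "Y = (\<lambda>\<omega>. \<lambda>j\<in>J. X \<omega> j - ereal (u j))"
  define y where "y = (\<lambda>j. \<pi> j * gp_pow (\<gamma> j) (u j / \<sigma> j))"
  define \<pi>' where "\<pi>' = (\<lambda>j. \<P>(\<omega> in M. ereal (u j) < X \<omega> j \<bar> \<exists>k\<in>J. ereal (u k) < X \<omega> k))"
  interpret M: prob_space M by fact
  have X[measurable]: "X \<in> M \<rightarrow>\<^sub>M Pi\<^sub>M I (\<lambda>_. borel)" using assms(2) by (simp add: I_def)
  have GP: "is_GP I \<sigma> \<gamma> \<pi> l \<mu>" using assms(3) by (simp add: I_def \<mu>_def)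
  have J: "J \<subseteq> I" and finI: "finite I" and I0: "I \<noteq> {}" and finJ: "finite J"
    using assms(4,5) finite_subset by (auto simp: I_def)
  have JI: "j \<in> J \<Longrightarrow> j \<in> I" for j using J by blast
  have u: "j \<in> J \<Longrightarrow> 0 \<le> u j" for j using assms(6) by blast
  have \<sigma>: "\<And>j. j \<in> I \<Longrightarrow> 0 < \<sigma> j" and \<pi>: "\<And>j. j \<in> I \<Longrightarrow> 0 < \<pi> j"
    and l: "is_stdf I l" and l1: "l (restrict \<pi> I) = 1"
    and AE\<mu>: "AE x in \<mu>. (\<forall>j\<in>I. x j < \<infinity> \<and> gp_lower (\<sigma> j) (\<gamma> j) \<le> x j) \<and> (\<exists>j\<in>I. 0 < x j)"
    using GP unfolding is_GP_def by auto
  have L: "is_stdf J L" unfolding L_def by (rule is_stdf_stdf_margin) fact+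
  have XJ[measurable]: "(\<lambda>\<omega>. X \<omega> j) \<in> borel_measurable M" if "j \<in> J" for j
    using JI[OF that] by measurable
  have A[measurable]: "A \<in> sets M" unfolding A_def using finJ by measurable

  \<comment> \<open>Admissibility of the new scales and the margins under \<open>M\<close>\<close>
  have AE_X: "AE \<omega> in M. \<forall>j\<in>J. X \<omega> j < \<infinity> \<and> gp_lower (\<sigma> j) (\<gamma> j) \<le> X \<omega> j"
    using AE_distrD[OF X AE\<mu>[unfolded \<mu>_def]] by eventually_elim (use JI in auto)
  \<comment> \<open>Only \<gamma> < 0 needs an argument. Since X_j is almost surely below some
    \<open>gp_approx\<close> value, a positive exceedance probability forces u_j below one of them,
    hence strictly below the endpoint.\<close>
  have \<sigma>u: "0 < \<sigma> j + \<gamma> j * u j" if j: "j \<in> J" for j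
  proof (cases "\<gamma> j < 0")
    case True
    have "\<exists>\<omega> n. ereal (u j) < X \<omega> j \<and> X \<omega> j \<le> ereal (gp_approx (\<sigma> j) (\<gamma> j) n)"
    proof (rule ccontr)
      assume neg: "\<not> ?thesis"
      have "AE \<omega> in M. \<not> ereal (u j) < X \<omega> j"
        using AE_distrD[OF X is_GP_AE_le_gp_approx[OF GP finI I0, unfolded \<mu>_def]]
        by eventually_elim (use neg JI[OF j] in blast)
      then have "\<P>(\<omega> in M. ereal (u j) < X \<omega> j) = 0"
        using j by (subst M.prob_eq_0) auto
      then show False using assms(7) j by auto
    qed
    then obtain n where "ereal (u j) < ereal (gp_approx (\<sigma> j) (\<gamma> j) n)"
      using less_le_trans by blast
    then have "\<gamma> j * gp_approx (\<sigma> j) (\<gamma> j) n \<le> \<gamma> j * u j"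
      using True by (intro mult_left_mono_neg) auto
    then show ?thesis using gp_approx_pos[OF \<sigma>[OF JI[OF j]], of "\<gamma> j" n] by linarith
  next
    case False
    then show ?thesis using \<sigma>[OF JI[OF j]] u[OF j] by (simp add: add_pos_nonneg)
  qed
  \<comment> \<open>Stated for every subset K of J because singletons are needed as well as J
    itself.\<close>
  have cdf: "M.prob {\<omega> \<in> space M. \<forall>j\<in>K. X \<omega> j \<le> ereal (x j)} =
      l (\<lambda>j\<in>I. \<pi> j * (if j \<in> K then gp_pow (\<gamma> j) (min (x j) 0 / \<sigma> j) else 1)) -
      stdf_margin I K l (\<lambda>j. \<pi> j * gp_pow (\<gamma> j) (x j / \<sigma> j))"
    if K: "K \<subseteq> J" and x: "\<And>j. j \<in> K \<Longrightarrow> 0 < \<sigma> j + \<gamma> j * x j" for K x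
  proof -
    have KI: "K \<subseteq> I" and finK: "finite K" using K J finJ finite_subset by blast+
    have "{z \<in> space (Pi\<^sub>M I (\<lambda>_. borel)). \<forall>j\<in>K. z j \<le> ereal (x j)} \<in> sets (Pi\<^sub>M I (\<lambda>_. borel))"
      using finK KI[THEN subsetD] by measurable
    then have "measure \<mu> {z \<in> space \<mu>. \<forall>j\<in>K. z j \<le> ereal (x j)} =
        M.prob {\<omega> \<in> space M. \<forall>j\<in>K. X \<omega> j \<le> ereal (x j)}"
      unfolding \<mu>_def using measurable_space[OF X]
      by (subst measure_distr) (auto intro!: arg_cong[where f = "measure M"])
    then show ?thesis using is_GP_margin_cdf[OF GP finI I0 KI, of x] x by simp
  qed

  \<comment> \<open>Exceedance probabilities and normalisation\<close>
  have y0: "0 < y j" if "j \<in> J" for j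
    using \<pi> \<sigma> \<sigma>u JI that by (auto simp: y_def intro!: mult_pos_pos gp_pow_pos)
  \<comment> \<open>As u >= 0, all powers at u \<and> 0 are 1; the first term of the cdf is then
    l(\<pi>) = 1, and complements leave only the margin of l.\<close>
  have \<pi>u: "(\<lambda>j\<in>I. \<pi> j * (if j \<in> K then gp_pow (\<gamma> j) (min (u j) 0 / \<sigma> j) else 1)) = restrict \<pi> I"
    if "K \<subseteq> J" for K
    using that u by (auto simp: min_absorb2 gp_pow_0 subset_iff)
  have prob_gt: "M.prob {\<omega> \<in> space M. \<exists>k\<in>K. ereal (u k) < X \<omega> k} = stdf_margin I K l y"
    if K: "K \<subseteq> J" for K
  proof -
    have finK: "finite K" using K finJ finite_subset by blast
    have "{\<omega> \<in> space M. \<exists>k\<in>K. ereal (u k) < X \<omega> k} =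
        space M - {\<omega> \<in> space M. \<forall>j\<in>K. X \<omega> j \<le> ereal (u j)}"
      by (auto simp: not_le)
    moreover have "{\<omega> \<in> space M. \<forall>j\<in>K. X \<omega> j \<le> ereal (u j)} \<in> sets M"
      using finK K by (intro sets.sets_Collect_finite_All) auto
    ultimately show ?thesis
      using K cdf[OF K, of u] \<sigma>u l1 by (simp add: M.prob_compl \<pi>u[OF K] subset_iff y_def)
  qed
  have PA: "M.prob A = L y" unfolding A_def L_def by (rule prob_gt) simp
  have Pj: "\<P>(\<omega> in M. ereal (u j) < X \<omega> j) = y j" if j: "j \<in> J" for j
    using prob_gt[of "{j}"] j is_stdf_unit[OF l finI JI[OF j], of "y j"] y0[OF j]
    by (simp add: stdf_margin_def if_distrib cong: if_cong)
  have yA: "y j \<le> M.prob A" if j: "j \<in> J" for j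
    unfolding Pj[OF j, symmetric] using j A by (intro M.finite_measure_mono) (auto simp: A_def)
  have A0: "0 < M.prob A" using yA y0 assms(4) by fastforce
  \<comment> \<open>Exceeding u_j already implies \<open>A\<close>, so conditioning merely divides
    y_j by the probability of \<open>A\<close>.\<close>
  have \<pi>': "\<pi>' j = y j / M.prob A" if j: "j \<in> J" for j
  proof -
    have "{\<omega> \<in> space M. ereal (u j) < X \<omega> j \<and> (\<exists>k\<in>J. ereal (u k) < X \<omega> k)} =
        {\<omega> \<in> space M. ereal (u j) < X \<omega> j}" using j by auto
    then show ?thesis unfolding \<pi>'_def cond_prob_def by (simp add: Pj[OF j] A_def)
  qed
  \<comment> \<open>The margin reads only coordinates in J, so extensional and unrestricted
    arguments may be exchanged.\<close>
  have L_restrict: "L (restrict w J) = L w" for w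
    unfolding L_def stdf_margin_def by (rule arg_cong[where f = l]) auto
  have L_scale: "L (\<lambda>j\<in>J. w j / M.prob A) = L (restrict w J) / M.prob A"
    if "\<And>j. j \<in> J \<Longrightarrow> 0 \<le> w j" for w
  proof -
    have "L (\<lambda>j\<in>J. 1 / M.prob A * restrict w J j) = 1 / M.prob A * L (restrict w J)"
      using that A0 by (intro is_stdf_mult[OF L finJ assms(4)]) auto
    moreover have "(\<lambda>j\<in>J. 1 / M.prob A * restrict w J j) = (\<lambda>j\<in>J. w j / M.prob A)" by auto
    ultimately show ?thesis by simp
  qed

  \<comment> \<open>The conditional law of the excesses\<close>
  have eA: "emeasure M A \<noteq> 0" using A0 by (simp add: M.emeasure_eq_measure)
  have psU: "prob_space (uniform_measure M A)"
    using eA by (intro prob_space_uniform_measure) auto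
  have Y[measurable]: "Y \<in> M \<rightarrow>\<^sub>M Pi\<^sub>M J (\<lambda>_. borel)" unfolding Y_def by measurable
  have YU: "Y \<in> uniform_measure M A \<rightarrow>\<^sub>M Pi\<^sub>M J (\<lambda>_. borel)" using Y by simp
  let ?\<nu> = "distr (uniform_measure M A) (Pi\<^sub>M J (\<lambda>_. borel)) Y"

  have "is_GP J (\<lambda>j. \<sigma> j + \<gamma> j * u j) \<gamma> \<pi>' L ?\<nu>"
    unfolding is_GP_def
  proof (intro conjI ballI allI impI)
    fix j assume j: "j \<in> J"
    show "0 < \<sigma> j + \<gamma> j * u j" by (rule \<sigma>u[OF j])
    show "0 < \<pi>' j" "\<pi>' j \<le> 1" using \<pi>'[OF j] y0[OF j] yA[OF j] A0 by simp_all
  next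
    show "is_stdf J L" by (rule L)
    \<comment> \<open>By homogeneity L(\<pi>') = L(y) / Pr[A], and L(y) is exactly Pr[A].\<close>
    have "restrict \<pi>' J = (\<lambda>j\<in>J. y j / M.prob A)" using \<pi>' by auto
    then show "L (restrict \<pi>' J) = 1"
      using L_scale[of y] y0 PA A0 by (simp add: L_restrict less_imp_le)
    show "prob_space ?\<nu>" using psU YU by (rule prob_space.prob_space_distr)
    show "sets ?\<nu> = sets (Pi\<^sub>M J (\<lambda>_. borel))" by simp
  next
    have "AE \<omega> in M. \<omega> \<in> A \<longrightarrow>
        (\<forall>j\<in>J. Y \<omega> j < \<infinity> \<and> gp_lower (\<sigma> j + \<gamma> j * u j) (\<gamma> j) \<le> Y \<omega> j) \<and> (\<exists>j\<in>J. 0 < Y \<omega> j)"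
      using AE_X
    proof eventually_elim
      case (elim \<omega>)
      have "Y \<omega> j < \<infinity> \<and> gp_lower (\<sigma> j + \<gamma> j * u j) (\<gamma> j) \<le> Y \<omega> j" if j: "j \<in> J" for j
      \<comment> \<open>A finite value moves with its lower endpoint by u_j. The value \<infinity>
        is excluded, and -\<infinity> is possible only where the lower endpoint is
        -\<infinity>.\<close>
      proof (cases "X \<omega> j")
        case (real r)
        have "- (\<sigma> j + \<gamma> j * u j) / \<gamma> j = - \<sigma> j / \<gamma> j - u j" if "\<gamma> j > 0"
          using that by (simp add: field_simps)
        then show ?thesis
          using elim[rule_format, OF j] j real by (auto simp: Y_def gp_lower_def split: if_splits)
      qed (use elim[rule_format, OF j] j in \<open>auto simp: Y_def gp_lower_def split: if_splits\<close>)
      moreover have "\<exists>j\<in>J. 0 < Y \<omega> j" if "\<omega> \<in> A"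
      proof -
        obtain k where k: "k \<in> J" "ereal (u k) < X \<omega> k" using \<open>\<omega> \<in> A\<close> by (auto simp: A_def)
        then have "0 < X \<omega> k - ereal (u k)" by (cases "X \<omega> k") auto
        then show ?thesis using k by (auto simp: Y_def)
      qed
      ultimately show ?case by blast
    qed
    then have "AE \<omega> in uniform_measure M A.
        (\<forall>j\<in>J. Y \<omega> j < \<infinity> \<and> gp_lower (\<sigma> j + \<gamma> j * u j) (\<gamma> j) \<le> Y \<omega> j) \<and> (\<exists>j\<in>J. 0 < Y \<omega> j)"
      by (rule AE_uniform_measureI[OF A])
    then show "AE x in ?\<nu>. (\<forall>j\<in>J. x j < \<infinity> \<and> gp_lower (\<sigma> j + \<gamma> j * u j) (\<gamma> j) \<le> x j) \<and>
        (\<exists>j\<in>J. 0 < x j)"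
      using finJ by (subst AE_distr_iff[OF YU]) (auto intro!: sets.sets_Collect)
  next
    fix x :: "nat \<Rightarrow> real"
    assume "\<forall>j\<in>J. 0 < \<sigma> j + \<gamma> j * u j + \<gamma> j * x j"
    then have x: "0 < \<sigma> j + \<gamma> j * u j + \<gamma> j * x j" if "j \<in> J" for j using that by blast
    have x0: "0 < \<sigma> j + \<gamma> j * u j + \<gamma> j * min (x j) 0" if "j \<in> J" for j
      using x[OF that] \<sigma>u[OF that] by (simp add: min_def)
    let ?B = "\<lambda>w. {\<omega> \<in> space M. \<forall>j\<in>J. X \<omega> j \<le> ereal (w j)}"
    let ?q = "\<lambda>w. \<lambda>j\<in>J. \<pi>' j * gp_pow (\<gamma> j) (w j / (\<sigma> j + \<gamma> j * u j))"
    have B[measurable]: "?B w \<in> sets M" for w using finJ by measurable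
    let ?a = "\<lambda>j. x j + u j" and ?b = "\<lambda>j. min (x j) 0 + u j"
    \<comment> \<open>\<open>gp_pow_add\<close> splits off y_j; dividing by Pr[A] turns it into the
      new \<pi>'_j, leaving the power with the new scale.\<close>
    have Lq: "L (\<lambda>j. \<pi> j * gp_pow (\<gamma> j) ((w j + u j) / \<sigma> j)) / M.prob A = L (?q w)"
      if w: "\<And>j. j \<in> J \<Longrightarrow> 0 < \<sigma> j + \<gamma> j * u j + \<gamma> j * w j" for w
    proof -
      have "?q w = (\<lambda>j\<in>J. \<pi> j * gp_pow (\<gamma> j) ((w j + u j) / \<sigma> j) / M.prob A)"
        using \<pi>' w \<sigma> \<sigma>u JI by (auto simp: y_def gp_pow_add)
      then show ?thesis
        using L_scale[of "\<lambda>j. \<pi> j * gp_pow (\<gamma> j) ((w j + u j) / \<sigma> j)"] \<pi> JI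
        by (simp add: L_restrict less_imp_le gp_pow_nonneg)
    qed
    have le: "X \<omega> j - ereal (u j) \<le> ereal (x j) \<longleftrightarrow> X \<omega> j \<le> ereal (?a j)" for \<omega> j
      by (cases "X \<omega> j") auto
    have "{z \<in> space (Pi\<^sub>M J (\<lambda>_. borel)). \<forall>j\<in>J. z j \<le> ereal (x j)} \<in> sets (Pi\<^sub>M J (\<lambda>_. borel))"
      using finJ by measurable
    then have "measure ?\<nu> {z \<in> space ?\<nu>. \<forall>j\<in>J. z j \<le> ereal (x j)} =
        measure (uniform_measure M A) (?B ?a)"
      using measurable_space[OF Y]
      by (subst measure_distr[OF YU]) (auto simp: Y_def le intro!: arg_cong2[where f = measure])
    also have "\<dots> = M.prob (A \<inter> ?B ?a) / M.prob A"
      using A0 by (intro measure_uniform_measure eA) auto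
    \<comment> \<open>Being below both x + u and u means being below (x \<and> 0) + u, so excluding
      X_J <= u removes exactly \<open>?B ?b\<close>.\<close>
    also have "A \<inter> ?B ?a = ?B ?a - ?B ?b"
    proof -
      have "X \<omega> j \<le> ereal (?b j) \<longleftrightarrow> X \<omega> j \<le> ereal (?a j) \<and> X \<omega> j \<le> ereal (u j)" for \<omega> j
        by (cases "X \<omega> j") auto
      then show ?thesis by (auto simp: A_def not_less[symmetric])
    qed
    also have "M.prob (?B ?a - ?B ?b) = M.prob (?B ?a) - M.prob (?B ?b)"
      by (intro M.finite_measure_Diff B) (auto intro: order_trans)
    also have "\<dots> = L (\<lambda>j. \<pi> j * gp_pow (\<gamma> j) (?b j / \<sigma> j)) - L (\<lambda>j. \<pi> j * gp_pow (\<gamma> j) (?a j / \<sigma> j))"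
    proof -
      \<comment> \<open>If x_j >= 0, both shifted thresholds are nonnegative because u_j >= 0; if
        x_j < 0, they coincide. Hence the first terms of the two cdfs cancel.\<close>
      have "(\<lambda>j\<in>I. \<pi> j * (if j \<in> J then gp_pow (\<gamma> j) (min (?a j) 0 / \<sigma> j) else 1)) =
          (\<lambda>j\<in>I. \<pi> j * (if j \<in> J then gp_pow (\<gamma> j) (min (?b j) 0 / \<sigma> j) else 1))"
      proof -
        have "min (?a j) 0 = min (?b j) 0" if "j \<in> J" for j using u[OF that] by linarith
        then show ?thesis by auto
      qed
      then show ?thesis
        using cdf[of J ?a] cdf[of J ?b] x x0 by (simp add: L_def algebra_simps)
    qed
    finally show "measure ?\<nu> {z \<in> space ?\<nu>. \<forall>j\<in>J. z j \<le> ereal (x j)} =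
        L (?q (\<lambda>j. min (x j) 0)) - L (?q x)"
      using Lq[of x] Lq[of "\<lambda>j. min (x j) 0"] x x0 by (simp add: diff_divide_distrib)
  qed
  then show ?thesis
    unfolding \<pi>'_def L_def A_def Y_def I_def .
qed

end
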